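(* Let $A\in\mathbb{R}^{n\times n}$ be symmetric, let $m\ge1$ be an integer and $s>1$. For $P,\widetilde P\in\mathbb{R}^{n\times k}$, if $A\succeq0$, then $$\mathrm{tr}\Big(P^{\mathrm T}\frac{\partial[\mathrm{tr}((P^{\mathrm T}AP)^m)]^s}{\partial P}\Big)=2sm\,[\mathrm{tr}((P^{\mathrm T}AP)^m)]^s,$$ $$\mathrm{tr}\Big(\widetilde P^{\mathrm T}\frac{\partial[\mathrm{tr}((P^{\mathrm T}AP)^m)]^s}{\partial P}\Big)\le[\mathrm{tr}((\widetilde P^{\mathrm T}A\widetilde P)^m)]^s+(2sm-1)[\mathrm{tr}((P^{\mathrm T}AP)^m)]^s .$$ In particular, (when $A\succeq 0$) $g(P)=[\mathrm{tr}((P^{\mathrm T}AP)^m)]^s$ satisfies conditions (1) and (2) of the definition of an atomic function for NPDo with $\mathbb{P}=\mathrm{St}(k,n)$, $Q=I_k$, $\alpha=1$ and $\beta=2sm-1$, and thus $[\mathrm{tr}((P^{\mathrm T}AP)^m)]^s$ for $s>1$ is an atomic function for NPDo.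
   Context: $1\le k\le n$; $\mathrm{St}(k,n)=\{P\in\mathbb{R}^{n\times k}: P^{\mathrm T}P=I_k\}$; $A\succeq0$ means symmetric positive semidefinite; $\partial f(P)/\partial P$ is the $n\times k$ matrix of partial derivatives with all entries of $P$ treated as independent. Atomic function for NPDo: a differentiable real function $f$ on a neighborhood $\{P\in\mathbb{R}^{n\times k}:\|P^{\mathrm T}P-I_k\|<\delta\}$ of $\mathrm{St}(k,n)$ for which there are a subset $\mathbb{P}\subseteq\mathrm{St}(k,n)$ and constants $\alpha>0$, $\beta\ge 0$, $\gamma=\alpha+\beta$ such that (1) $\mathrm{tr}\big(P^{\mathrm T}\frac{\partial f(P)}{\partial P}\big)=\gamma f(P)$ for all $P\in\mathbb{P}$; and (2) given $P\in\mathbb{P}$ and $\widehat P\in\mathrm{St}(k,n)$, there exists $Q\in\mathrm{St}(k,k)$ such that $\widetilde P=\widehat PQ\in\mathbb{P}$ and $\mathrm{tr}\big(\widehat P^{\mathrm T}\frac{\partial f(P)}{\partial P}\big)\le\alpha f(\widetilde P)+\beta f(P)$. *)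

theory Defs
  imports "HOL-Analysis.Analysis"
begin

text \<open>An \<open>n \<times> k\<close> real matrix is an element of \<^typ>\<open>real^'k^'n\<close>
  (rows indexed by \<open>'n\<close>, columns by \<open>'k\<close>), with \<open>n = CARD('n)\<close> and \<open>k = CARD('k)\<close>.\<close>

definition stiefel :: "(real^'k^'n) set" where
  "stiefel = {P. transpose P ** P = mat 1}"

definition pos_semidef :: "real^'n^'n \<Rightarrow> bool" where
  "pos_semidef A \<longleftrightarrow> transpose A = A \<and> (\<forall>x. 0 \<le> x \<bullet> (A *v x))"

text \<open>The power operation \<open>^\<close> is not available for the matrix product: multiplication
  on the type \<open>vec\<close> is componentwise.\<close>

primrec matpow :: "real^'n^'n \<Rightarrow> nat \<Rightarrow> real^'n^'n" where
  "matpow M 0 = mat 1"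
| "matpow M (Suc m) = M ** matpow M m"

text \<open>The matrix \<open>\<partial>f(P)/\<partial>P\<close>; \<^term>\<open>axis i (axis j 1)\<close> is the matrix unit
  with entry 1 in row \<open>i\<close>, column \<open>j\<close>. It is meaningful only where the partial derivatives exist,
  since \<^const>\<open>deriv\<close> is total.\<close>

definition matrix_grad :: "(real^'k^'n \<Rightarrow> real) \<Rightarrow> real^'k^'n \<Rightarrow> real^'k^'n" where
  "matrix_grad f P = (\<chi> i j. deriv (\<lambda>t. f (P + t *\<^sub>R axis i (axis j 1))) 0)"

text \<open>The norm below is the Frobenius norm. As \<open>\<delta>\<close> is existentially quantified in
  \<open>atomic_NPDo\<close>, the choice of matrix norm is immaterial.\<close>

definition stiefel_nbhd :: "real \<Rightarrow> (real^'k^'n) set" where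
  "stiefel_nbhd \<delta> = {P. norm (transpose P ** P - mat 1) < \<delta>}"

definition NPDo_cond1 ::
  "(real^'k^'n \<Rightarrow> real) \<Rightarrow> (real^'k^'n) set \<Rightarrow> real \<Rightarrow> bool" where
  "NPDo_cond1 f PP \<gamma> \<longleftrightarrow> (\<forall>P\<in>PP. trace (transpose P ** matrix_grad f P) = \<gamma> * f P)"

text \<open>\<open>Q\<close> is a valid choice in the second condition for the given \<open>P\<close> and \<open>Ph\<close>
  (the matrix written \<open>P\<close> with a hat).\<close>

definition NPDo_cond2_witness ::
  "(real^'k^'n \<Rightarrow> real) \<Rightarrow> (real^'k^'n) set \<Rightarrow> real \<Rightarrow> real
    \<Rightarrow> real^'k^'n \<Rightarrow> real^'k^'n \<Rightarrow> real^'k^'k \<Rightarrow> bool" where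
  "NPDo_cond2_witness f PP \<alpha> \<beta> P Ph Q \<longleftrightarrow>
     Q \<in> stiefel \<and> Ph ** Q \<in> PP \<and>
     trace (transpose Ph ** matrix_grad f P) \<le> \<alpha> * f (Ph ** Q) + \<beta> * f P"

definition NPDo_cond2 ::
  "(real^'k^'n \<Rightarrow> real) \<Rightarrow> (real^'k^'n) set \<Rightarrow> real \<Rightarrow> real \<Rightarrow> bool" where
  "NPDo_cond2 f PP \<alpha> \<beta> \<longleftrightarrow>
     (\<forall>P\<in>PP. \<forall>Ph\<in>stiefel. \<exists>Q. NPDo_cond2_witness f PP \<alpha> \<beta> P Ph Q)"

definition atomic_NPDo :: "(real^'k^'n \<Rightarrow> real) \<Rightarrow> bool" where
  "atomic_NPDo f \<longleftrightarrow>
     (\<exists>\<delta>>0. f differentiable_on stiefel_nbhd \<delta>) \<and>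
     (\<exists>PP \<alpha> \<beta>. PP \<subseteq> stiefel \<and> \<alpha> > 0 \<and> \<beta> \<ge> 0 \<and>
        NPDo_cond1 f PP (\<alpha> + \<beta>) \<and> NPDo_cond2 f PP \<alpha> \<beta>)"

text \<open>For positive semidefinite \<open>A\<close> the base of the real power is nonnegative, and
  \<open>0 powr s = 0\<close> is the intended value.\<close>

definition trace_pow :: "real^'n^'n \<Rightarrow> nat \<Rightarrow> real \<Rightarrow> real^'k^'n \<Rightarrow> real" where
  "trace_pow A m s P = trace (matpow (transpose P ** A ** P) m) powr s"

end

theory Submission
  imports Defs
begin

text \<open>Write \<open>f(P) = tr ((P\<^sup>T A P)\<^sup>m)\<close>. Its derivative in the direction \<open>X\<close> is \<open>2m tr (X\<^sup>T A P M\<^sup>m\<^sup>-\<^sup>1)\<close>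
  with \<open>M = P\<^sup>T A P\<close>; taking \<open>X = P\<close> gives Euler's identity. For exponent \<open>s = 1\<close> the
  inequality holds because the indefinite mixed trace is bounded by a positive semidefinite one, which is
  then handled by Klein's inequality in eigenbases. The case \<open>s > 1\<close> follows by multiplying
  with \<open>s f(P)\<^sup>s\<^sup>-\<^sup>1\<close> and applying Young's inequality to \<open>s f(P)\<^sup>s\<^sup>-\<^sup>1 f(Q)\<close>.\<close>

section \<open>The spectral theorem for self-adjoint maps\<close>

text \<open>A maximiser \<open>x\<close> of the quadratic form \<open>y \<bullet> f y\<close> on the unit sphere of \<open>W\<close> is an eigenvector:
  \<open>\<mu> (y \<bullet> y) - y \<bullet> f y\<close> is nonnegative on \<open>W\<close> and vanishes at \<open>x\<close>, so its derivative at \<open>x\<close> in the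
  direction \<open>\<mu> x - f x\<close> vanishes.\<close>

lemma self_adjoint_eigenvector_in_subspace:
  fixes f :: "'a::euclidean_space \<Rightarrow> 'a"
  assumes lin: "linear f"
    and sa: "\<And>x y. f x \<bullet> y = x \<bullet> f y"
    and W: "subspace W" and inv: "\<And>x. x \<in> W \<Longrightarrow> f x \<in> W"
    and ne: "W \<noteq> {0}"
  obtains x \<mu> where "x \<in> W" "norm x = 1" "f x = \<mu> *\<^sub>R x"
proof -
  let ?S = "W \<inter> sphere 0 1"
  obtain w where w: "w \<in> W" "w \<noteq> 0"
    using ne subspace_0[OF W] by blast
  have "(1 / norm w) *\<^sub>R w \<in> ?S"
    using w W by (simp add: subspace_scale)
  then have nonempty: "?S \<noteq> {}" by blast
  have comp: "compact ?S"
    by (intro closed_Int_compact closed_subspace W compact_sphere)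
  have "continuous_on ?S (\<lambda>x. x \<bullet> f x)"
    by (intro continuous_intros linear_continuous_on_compose[OF _ lin])
  then obtain x where x: "x \<in> ?S" and mx: "\<And>y. y \<in> ?S \<Longrightarrow> y \<bullet> f y \<le> x \<bullet> f x"
    using continuous_attains_sup[OF comp nonempty] by blast
  define \<mu> where "\<mu> = x \<bullet> f x"
  define q where "q y = \<mu> * (y \<bullet> y) - y \<bullet> f y" for y
  have q_nonneg: "0 \<le> q y" if "y \<in> W" for y
  proof (cases "y = 0")
    case True
    then show ?thesis using linear_0[OF lin] by (simp add: q_def)
  next
    case False
    have "(1 / norm y) *\<^sub>R y \<in> ?S"
      using that False W by (simp add: subspace_scale)
    from mx[OF this] have "(y \<bullet> f y) / (norm y)\<^sup>2 \<le> \<mu>"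
      by (simp add: \<mu>_def linear_cmul[OF lin] power2_eq_square)
    then show ?thesis
      using False by (simp add: q_def power2_norm_eq_inner divide_simps)
  qed
  have xx: "x \<bullet> x = 1"
    using x by (simp add: norm_eq_1)
  have qx: "q x = 0"
    by (simp add: q_def xx \<mu>_def)
  define d where "d = \<mu> *\<^sub>R x - f x"
  have dW: "d \<in> W"
    using x inv W by (simp add: d_def subspace_diff subspace_scale)
  have expand: "q (x + t *\<^sub>R d) = 2 * t * (d \<bullet> d) + t\<^sup>2 * q d" for t
  proof -
    have "q (x + t *\<^sub>R d) = q x + 2 * t * (\<mu> * (x \<bullet> d) - f x \<bullet> d) + t\<^sup>2 * q d"
      unfolding q_def
      by (simp add: linear_add[OF lin] linear_cmul[OF lin] inner_add_left inner_add_right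
          inner_commute[of d x] sa[of x d] sa[of d x, symmetric] inner_commute[of d "f x"]
          inner_commute[of x "f d"]
          power2_eq_square algebra_simps)
    also have "\<mu> * (x \<bullet> d) - f x \<bullet> d = d \<bullet> d"
      by (subst (3) d_def) (simp add: inner_diff_left)
    finally show ?thesis by (simp add: qx)
  qed
  have "d = 0"
  proof (rule ccontr)
    assume "d \<noteq> 0"
    then have N: "d \<bullet> d > 0" by simp
    have qd: "q d \<ge> 0" using q_nonneg dW by blast
    \<comment> \<open>Minimising \<open>2 * t * (d \<bullet> d) + t\<^sup>2 * q d\<close> would give
      the denominator \<open>q d\<close>; adding 1 keeps it positive when \<open>q d = 0\<close>,
      and the value stays negative.\<close>
    define t where "t = - (d \<bullet> d) / (q d + 1)"
    have t: "t < 0" using N qd by (simp add: t_def divide_neg_pos)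
    have "t * (q d + 1) = - (d \<bullet> d)" using qd by (simp add: t_def)
    then have tq: "t * q d = - (d \<bullet> d) - t" by (simp add: algebra_simps)
    have "q (x + t *\<^sub>R d) = t * ((d \<bullet> d) - t)"
      unfolding expand power2_eq_square mult.assoc tq by (simp add: algebra_simps)
    also have "\<dots> < 0" using t N by (intro mult_neg_pos) linarith+
    finally have "q (x + t *\<^sub>R d) < 0" .
    moreover have "x + t *\<^sub>R d \<in> W"
      using x dW W by (simp add: subspace_add subspace_scale)
    ultimately show False using q_nonneg by force
  qed
  then show thesis
    using that[of x \<mu>] x by (simp add: d_def)
qed

definition orthonormal_basis :: "'a::euclidean_space set \<Rightarrow> bool" where
  "orthonormal_basis B \<longleftrightarrow>
     finite B \<and> pairwise orthogonal B \<and> (\<forall>v\<in>B. norm v = 1) \<and> span B = UNIV"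

text \<open>An orthonormal set of eigenvectors of maximal size spans. Otherwise its orthogonal
  complement is nonzero and, by self-adjointness, invariant under \<open>f\<close>, so it contains a
  further unit eigenvector.\<close>

theorem self_adjoint_eigenbasis:
  fixes f :: "'a::euclidean_space \<Rightarrow> 'a"
  assumes lin: "linear f"
    and sa: "\<And>x y. f x \<bullet> y = x \<bullet> f y"
  obtains B e where "orthonormal_basis B" "\<And>v. v \<in> B \<Longrightarrow> f v = e v *\<^sub>R v"
proof -
  define good where "good B \<longleftrightarrow> pairwise orthogonal B \<and>
    (\<forall>v\<in>B. norm v = 1 \<and> (\<exists>c. f v = c *\<^sub>R v))" for B
  have indep: "independent B" if "good B" for B
    using that by (intro pairwise_orthogonal_independent) (auto simp: good_def)
  have "good {}" by (simp add: good_def)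
  moreover have "\<forall>B. good B \<longrightarrow> card B \<le> DIM('a)"
    using indep independent_bound by blast
  ultimately obtain B where B: "good B" and Bmax: "\<And>C. good C \<Longrightarrow> card C \<le> card B"
    using ex_has_greatest_nat[of good "{}" card "Suc (DIM('a))"] by (auto simp: less_Suc_eq_le)
  have fin: "finite B" using indep[OF B] independent_bound by blast
  have span: "span B = UNIV"
  proof (rule ccontr)
    assume *: "span B \<noteq> UNIV"
    let ?W = "{x. \<forall>y\<in>B. orthogonal y x}"
    have W: "subspace ?W" by (rule subspace_orthogonal_to_vectors)
    have inv: "f x \<in> ?W" if "x \<in> ?W" for x
    proof clarify
      fix y assume y: "y \<in> B"
      then obtain c where "f y = c *\<^sub>R y" using B by (auto simp: good_def)
      then have "y \<bullet> f x = c * (y \<bullet> x)" by (simp add: sa[symmetric])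
      then show "orthogonal y (f x)" using that y by (simp add: orthogonal_def)
    qed
    have "span B \<subset> span UNIV" using * by auto
    then obtain w where "w \<noteq> 0" "w \<in> span UNIV" "\<And>y. y \<in> span B \<Longrightarrow> orthogonal w y"
      by (rule orthogonal_to_subspace_exists_gen) (rule that)
    then have "w \<in> ?W" "w \<noteq> 0"
      by (auto simp: orthogonal_commute span_base)
    then have "?W \<noteq> {0}" by blast
    then obtain x c where x: "x \<in> ?W" "norm x = 1" "f x = c *\<^sub>R x"
      using self_adjoint_eigenvector_in_subspace[OF lin sa W inv] by blast
    have "x \<notin> B" using x by (auto simp: orthogonal_self)
    moreover have "good (insert x B)"
      using B x by (auto simp: good_def pairwise_insert orthogonal_commute)
    ultimately show False using Bmax[of "insert x B"] fin by simp
  qed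
  have "\<forall>v\<in>B. \<exists>c. f v = c *\<^sub>R v" using B by (auto simp: good_def)
  then obtain e where "\<And>v. v \<in> B \<Longrightarrow> f v = e v *\<^sub>R v" by metis
  moreover have "orthonormal_basis B"
    using B fin span by (auto simp: orthonormal_basis_def good_def)
  ultimately show thesis using that by blast
qed

text \<open>The difference of the two sides is orthogonal to every element of \<open>B\<close>,
  hence to the whole space, hence to itself.\<close>

lemma orthonormal_basis_expansion:
  fixes x :: "'a::euclidean_space"
  assumes "orthonormal_basis B"
  shows "(\<Sum>v\<in>B. (x \<bullet> v) *\<^sub>R v) = x"
proof -
  let ?y = "x - (\<Sum>v\<in>B. (x \<bullet> v) *\<^sub>R v)"
  have fin: "finite B" and nrm: "\<And>v. v \<in> B \<Longrightarrow> v \<bullet> v = 1"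
    and orth: "\<And>u v. u \<in> B \<Longrightarrow> v \<in> B \<Longrightarrow> u \<noteq> v \<Longrightarrow> u \<bullet> v = 0"
    using assms by (auto simp: orthonormal_basis_def pairwise_def orthogonal_def norm_eq_1)
  have "orthogonal ?y u" if "u \<in> B" for u
  proof -
    have "(\<Sum>v\<in>B. (x \<bullet> v) * (v \<bullet> u)) = (\<Sum>v\<in>B. if v = u then x \<bullet> u else 0)"
      by (rule sum.cong) (use nrm orth that in auto)
    then show ?thesis
      using fin that by (simp add: orthogonal_def inner_diff_left inner_sum_left)
  qed
  then have "orthogonal ?y ?y"
    using orthogonal_to_span[of ?y B ?y] assms
    by (simp add: orthonormal_basis_def orthogonal_commute)
  then show ?thesis by (simp add: orthogonal_self)
qed

lemma orthonormal_basis_inner: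
  assumes "orthonormal_basis B"
  shows "x \<bullet> y = (\<Sum>v\<in>B. (x \<bullet> v) * (v \<bullet> y))"
  by (subst orthonormal_basis_expansion[OF assms, of x, symmetric]) (simp add: inner_sum_left)

section \<open>Traces of products of positive semidefinite matrices\<close>

text \<open>Expanding the diagonal entries in \<open>B\<close> and swapping the sums reassembles
  \<open>M *v v\<close> from the standard basis. Traces can then be computed in an
  eigenbasis.\<close>

lemma trace_orthonormal_basis:
  fixes M :: "real^'n^'n"
  assumes B: "orthonormal_basis B"
  shows "trace M = (\<Sum>v\<in>B. v \<bullet> (M *v v))"
proof -
  have "trace M = (\<Sum>i\<in>UNIV. axis i 1 \<bullet> (M *v axis i 1))"
    by (simp add: trace_def inner_axis' matrix_vector_mult_basis column_def)
  also have "\<dots> = (\<Sum>i\<in>UNIV. \<Sum>v\<in>B. (axis i 1 \<bullet> v) * (v \<bullet> (M *v axis i 1)))"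
    by (subst orthonormal_basis_inner[OF B]) simp
  also have "\<dots> = (\<Sum>v\<in>B. \<Sum>i\<in>UNIV. v $ i * (v \<bullet> (M *v axis i 1)))"
    by (subst sum.swap) (simp add: inner_axis')
  also have "\<dots> = (\<Sum>v\<in>B. v \<bullet> (M *v v))"
  proof (rule sum.cong[OF refl])
    fix v :: "real^'n"
    have "M *v v = (\<Sum>i\<in>UNIV. v $ i *\<^sub>R (M *v axis i 1))"
      by (simp add: matrix_mult_sum[of M v] matrix_vector_mult_basis scalar_mult_eq_scaleR)
    then show "(\<Sum>i\<in>UNIV. v $ i * (v \<bullet> (M *v axis i 1))) = v \<bullet> (M *v v)"
      by (simp add: inner_sum_right)
  qed
  finally show ?thesis .
qed

lemma matpow_eigenvector:
  assumes "M *v v = c *\<^sub>R v"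
  shows "matpow M j *v v = c ^ j *\<^sub>R v"
  by (induction j)
    (simp_all add: assms matrix_vector_mul_assoc[symmetric] matrix_vector_mult_scaleR)

lemma symmetric_matrix_eigenbasis:
  fixes M :: "real^'n^'n"
  assumes "transpose M = M"
  obtains B e where "orthonormal_basis B" "\<And>v. v \<in> B \<Longrightarrow> M *v v = e v *\<^sub>R v"
proof (rule self_adjoint_eigenbasis[of "(*v) M"])
  show "linear ((*v) M)" by simp
  show "(M *v x) \<bullet> y = x \<bullet> (M *v y)" for x y
    by (metis assms dot_lmul_matrix vector_transpose_matrix)
qed (use that in blast)

lemma pos_semidef_eigenbasis:
  assumes "pos_semidef M"
  obtains B e where "orthonormal_basis B" "\<And>v. v \<in> B \<Longrightarrow> M *v v = e v *\<^sub>R v"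
    "\<And>v. v \<in> B \<Longrightarrow> 0 \<le> e v"
proof -
  obtain B e where B: "orthonormal_basis B" and e: "\<And>v. v \<in> B \<Longrightarrow> M *v v = e v *\<^sub>R v"
    using symmetric_matrix_eigenbasis assms unfolding pos_semidef_def by metis
  have "0 \<le> e v" if "v \<in> B" for v
  proof -
    have "v \<bullet> v = 1" using B that by (simp add: orthonormal_basis_def norm_eq_1)
    moreover have "0 \<le> v \<bullet> (M *v v)" using assms by (simp add: pos_semidef_def)
    ultimately show ?thesis by (simp add: e[OF that])
  qed
  with B e show thesis using that by blast
qed

text \<open>In an eigenbasis of \<open>M\<close> the trace is a sum of values of the quadratic form
  of \<open>C\<close>, weighted by powers of nonnegative eigenvalues.\<close>

lemma trace_mult_matpow_nonneg:
  assumes C: "pos_semidef C" and M: "pos_semidef M"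
  shows "0 \<le> trace (C ** matpow M j)"
proof -
  obtain B e where B: "orthonormal_basis B" and e: "\<And>v. v \<in> B \<Longrightarrow> M *v v = e v *\<^sub>R v"
    and nn: "\<And>v. v \<in> B \<Longrightarrow> 0 \<le> e v"
    using pos_semidef_eigenbasis[OF M] by blast
  have "trace (C ** matpow M j) = (\<Sum>v\<in>B. e v ^ j * (v \<bullet> (C *v v)))"
    unfolding trace_orthonormal_basis[OF B]
    by (rule sum.cong)
      (simp_all add: matrix_vector_mul_assoc[symmetric] matpow_eigenvector[OF e]
        matrix_vector_mult_scaleR)
  also have "\<dots> \<ge> 0"
    using nn C by (intro sum_nonneg mult_nonneg_nonneg zero_le_power) (auto simp: pos_semidef_def)
  finally show ?thesis .
qed

text \<open>This is the tangent line inequality for the power \<open>Suc m\<close> at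
  \<open>b\<close>. The induction step multiplies by \<open>b\<close> and uses that
  \<open>a - b\<close> and \<open>a ^ Suc m - b ^ Suc m\<close> have the same sign.\<close>

lemma Young_power:
  fixes a b :: real
  assumes "0 \<le> a" "0 \<le> b"
  shows "real (Suc m) * (a * b ^ m) \<le> a ^ Suc m + real m * b ^ Suc m"
proof (induction m)
  case 0
  show ?case by simp
next
  case (Suc m)
  have "0 \<le> (a - b) * (a ^ Suc m - b ^ Suc m)"
    using assms power_mono[of a b "Suc m"] power_mono[of b a "Suc m"]
    by (cases "a \<le> b") (auto intro: mult_nonneg_nonneg mult_nonpos_nonpos)
  then have "a * b ^ Suc m + a ^ Suc m * b \<le> a ^ Suc (Suc m) + b ^ Suc (Suc m)"
    by (simp add: algebra_simps)
  moreover have "real (Suc m) * (a * b ^ m) * b \<le> (a ^ Suc m + real m * b ^ Suc m) * b"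
    using Suc assms by (intro mult_right_mono)
  ultimately show ?case by (simp add: algebra_simps)
qed

text \<open>Expanding all three traces in the eigenbases of \<open>N\<close> and \<open>M\<close> reduces this to
  \<open>Young_power\<close> for pairs of eigenvalues, weighted by the numbers \<open>(u \<bullet> v)\<^sup>2\<close>.\<close>

lemma Klein_trace_matpow:
  assumes N: "pos_semidef N" and M: "pos_semidef M"
  shows "real (Suc m) * trace (N ** matpow M m)
    \<le> trace (matpow N (Suc m)) + real m * trace (matpow M (Suc m))"
proof -
  obtain B e where B: "orthonormal_basis B" and e: "\<And>v. v \<in> B \<Longrightarrow> M *v v = e v *\<^sub>R v"
    and e0: "\<And>v. v \<in> B \<Longrightarrow> 0 \<le> e v"
    using pos_semidef_eigenbasis[OF M] by blast
  obtain C d where C: "orthonormal_basis C" and d: "\<And>v. v \<in> C \<Longrightarrow> N *v v = d v *\<^sub>R v"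
    and d0: "\<And>v. v \<in> C \<Longrightarrow> 0 \<le> d v"
    using pos_semidef_eigenbasis[OF N] by blast
  \<comment> \<open>General exponents let one formula serve all three traces, with
    \<open>(i, j)\<close> equal to \<open>(1, m)\<close>, \<open>(Suc m, 0)\<close> and
    \<open>(0, Suc m)\<close>.\<close>
  have expand: "trace (matpow N i ** matpow M j)
      = (\<Sum>v\<in>B. \<Sum>u\<in>C. (u \<bullet> v)\<^sup>2 * (d u ^ i * e v ^ j))" for i j
    unfolding trace_orthonormal_basis[OF B]
  proof (rule sum.cong[OF refl])
    fix v assume v: "v \<in> B"
    have "(matpow N i ** matpow M j) *v v = e v ^ j *\<^sub>R (matpow N i *v v)"
      by (simp add: matrix_vector_mul_assoc[symmetric] matpow_eigenvector[OF e[OF v]]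
          matrix_vector_mult_scaleR)
    also have "matpow N i *v v = (\<Sum>u\<in>C. (v \<bullet> u) *\<^sub>R (d u ^ i *\<^sub>R u))"
    proof -
      have "matpow N i *v v = matpow N i *v (\<Sum>u\<in>C. (v \<bullet> u) *\<^sub>R u)"
        by (simp only: orthonormal_basis_expansion[OF C])
      also have "\<dots> = (\<Sum>u\<in>C. (v \<bullet> u) *\<^sub>R (matpow N i *v u))"
        by (simp add: vec.sum matrix_vector_mult_scaleR)
      also have "\<dots> = (\<Sum>u\<in>C. (v \<bullet> u) *\<^sub>R (d u ^ i *\<^sub>R u))"
        by (rule sum.cong) (simp_all only: matpow_eigenvector[OF d])
      finally show ?thesis .
    qed
    finally show "v \<bullet> ((matpow N i ** matpow M j) *v v)
        = (\<Sum>u\<in>C. (u \<bullet> v)\<^sup>2 * (d u ^ i * e v ^ j))"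
      by (simp add: inner_sum_right sum_distrib_left power2_eq_square inner_commute mult_ac)
  qed
  have "real (Suc m) * trace (N ** matpow M m)
      = (\<Sum>v\<in>B. \<Sum>u\<in>C. (u \<bullet> v)\<^sup>2 * (real (Suc m) * (d u * e v ^ m)))"
    using expand[of 1 m] by (simp add: sum_distrib_left mult_ac del: of_nat_Suc)
  also have "\<dots> \<le> (\<Sum>v\<in>B. \<Sum>u\<in>C. (u \<bullet> v)\<^sup>2 * (d u ^ Suc m + real m * e v ^ Suc m))"
    using d0 e0 by (intro sum_mono mult_left_mono Young_power) auto
  also have "\<dots> = trace (matpow N (Suc m)) + real m * trace (matpow M (Suc m))"
    using expand[of "Suc m" 0] expand[of 0 "Suc m"]
    by (simp add: sum_distrib_left sum.distrib algebra_simps)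
  finally show ?thesis .
qed

section \<open>The gradient\<close>

lemma bounded_bilinear_matrix_mult:
  "bounded_bilinear ((**) :: real^'m^'n \<Rightarrow> real^'p^'m \<Rightarrow> real^'p^'n)"
proof -
  have "bilinear ((**) :: real^'m^'n \<Rightarrow> real^'p^'m \<Rightarrow> real^'p^'n)"
    unfolding bilinear_def linear_iff
    by (auto simp: matrix_matrix_mult_def vec_eq_iff sum.distrib sum_distrib_left algebra_simps)
  then show ?thesis by (simp add: bilinear_conv_bounded_bilinear)
qed

lemma bounded_linear_transpose: "bounded_linear (transpose :: real^'m^'n \<Rightarrow> real^'n^'m)"
  by (simp add: linear_conv_bounded_linear[symmetric] linear_iff transpose_def vec_eq_iff)

lemma bounded_linear_trace: "bounded_linear (trace :: real^'n^'n \<Rightarrow> real)"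
  by (simp add: linear_conv_bounded_linear[symmetric] linear_iff trace_def sum.distrib
      sum_distrib_left)

lemmas matrix_mult_add_left = bounded_bilinear.add_left[OF bounded_bilinear_matrix_mult]
lemmas matrix_mult_diff_left = bounded_bilinear.diff_left[OF bounded_bilinear_matrix_mult]
lemmas matrix_mult_diff_right = bounded_bilinear.diff_right[OF bounded_bilinear_matrix_mult]

lemma matpow_Suc_right: "M ** matpow M j = matpow M j ** M"
  by (induction j) (simp, metis matpow.simps(2) matrix_mul_assoc)

lemma transpose_matpow: "transpose (matpow M j) = matpow (transpose M) j"
  by (induction j) (simp_all add: matrix_transpose_mul matpow_Suc_right)

text \<open>Transposition preserves the trace and the symmetric power, and cyclicity restores the
  order of the factors. This merges the two mixed terms that arise from product rules and from
  expanding squares.\<close>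

lemma trace_mixed_swap:
  fixes A :: "real^'n^'n" and P Q :: "real^'k^'n"
  assumes sym: "transpose A = A"
  shows "trace (transpose P ** A ** Q ** matpow (transpose P ** A ** P) j)
    = trace (transpose Q ** A ** P ** matpow (transpose P ** A ** P) j)"
proof -
  let ?N = "matpow (transpose P ** A ** P) j"
  have N: "transpose ?N = ?N"
    by (simp add: transpose_matpow matrix_transpose_mul sym matrix_mul_assoc)
  have "trace (transpose P ** A ** Q ** ?N) = trace (transpose (transpose P ** A ** Q ** ?N))"
    by (simp add: trace_def transpose_def)
  also have "\<dots> = trace (?N ** (transpose Q ** A ** P))"
    by (subst matrix_transpose_mul)
      (simp only: N, simp add: matrix_transpose_mul sym matrix_mul_assoc)
  also have "\<dots> = trace (transpose Q ** A ** P ** ?N)"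
    by (rule trace_mul_sym)
  finally show ?thesis .
qed

text \<open>The extra factor \<open>matpow M j\<close> makes the induction on \<open>m\<close> go through.\<close>

lemma matpow_has_derivative:
  fixes M :: "real^'n^'n"
  obtains D where "((\<lambda>X. matpow X m) has_derivative D) (at M)"
    "\<And>H j. trace (D H ** matpow M j) = real m * trace (H ** matpow M (m - 1 + j))"
proof -
  have "\<exists>D. ((\<lambda>X. matpow X m) has_derivative D) (at M) \<and>
    (\<forall>H j. trace (D H ** matpow M j) = real m * trace (H ** matpow M (m - 1 + j)))"
  proof (induction m)
    case 0
    have "((\<lambda>X. matpow X 0) has_derivative (\<lambda>H. 0)) (at M)" by simp
    then show ?case
      by (intro exI[of _ "\<lambda>H. 0"])
        (simp add: bounded_bilinear.zero_left[OF bounded_bilinear_matrix_mult]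
          linear_0[OF bounded_linear.linear[OF bounded_linear_trace]])
  next
    case (Suc m)
    then obtain D where D: "((\<lambda>X. matpow X m) has_derivative D) (at M)"
      and tr: "\<And>H j. trace (D H ** matpow M j) = real m * trace (H ** matpow M (m - 1 + j))"
      by blast
    have add: "matpow M m ** matpow M j = matpow M (m + j)" for j
      by (induction m) (simp_all add: matrix_mul_assoc[symmetric])
    have "trace ((M ** D H + H ** matpow M m) ** matpow M j)
        = real (Suc m) * trace (H ** matpow M (Suc m - 1 + j))" for H j
    proof -
      \<comment> \<open>Cyclicity moves the leading \<open>M\<close> into the power on the right, so
        the induction hypothesis is used at \<open>Suc j\<close>.\<close>
      have "trace (M ** D H ** matpow M j) = trace (D H ** matpow M (Suc j))"
        by (metis matpow.simps(2) matpow_Suc_right matrix_mul_assoc trace_mul_sym)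
      also have "\<dots> = real m * trace (H ** matpow M (m + j))"
        \<comment> \<open>The exponents \<open>m - 1 + Suc j\<close> and \<open>m + j\<close> differ
          only for \<open>m = 0\<close>, where the factor \<open>real m\<close> vanishes.\<close>
        unfolding tr by (cases m) auto
      finally show ?thesis
        by (simp add: matrix_mult_add_left trace_add matrix_mul_assoc[symmetric] add
            algebra_simps)
    qed
    moreover have "((\<lambda>X. matpow X (Suc m)) has_derivative (\<lambda>H. M ** D H + H ** matpow M m)) (at M)"
      unfolding matpow.simps
      by (rule bounded_bilinear.FDERIV[OF bounded_bilinear_matrix_mult has_derivative_ident D])
    ultimately show ?case by blast
  qed
  then show thesis using that by blast
qed

text \<open>The product rule for \<open>transpose P ** A ** P\<close> yields two terms with equal
  contributions to the trace, whence the factor 2.\<close>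

lemma trace_matpow_congruence_has_derivative:
  fixes A :: "real^'n^'n" and P :: "real^'k^'n"
  assumes sym: "transpose A = A"
  shows "((\<lambda>P. trace (matpow (transpose P ** A ** P) m)) has_derivative
    (\<lambda>X. 2 * real m * trace (transpose X ** A ** P ** matpow (transpose P ** A ** P) (m - 1)))) (at P)"
proof -
  let ?M = "transpose P ** A ** P"
  let ?N = "matpow ?M (m - 1)"
  obtain D where D: "((\<lambda>X. matpow X m) has_derivative D) (at ?M)"
    and tr: "\<And>H j. trace (D H ** matpow ?M j) = real m * trace (H ** matpow ?M (m - 1 + j))"
    using matpow_has_derivative[of m ?M] by blast
  have "((\<lambda>P. transpose P ** A ** P) has_derivative
      (\<lambda>X. transpose P ** A ** X + transpose X ** A ** P)) (at P)"
    using bounded_bilinear.FDERIV[OF bounded_bilinear_matrix_mult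
        bounded_linear.has_derivative[OF bounded_linear_compose[OF
            bounded_bilinear.bounded_linear_left[OF bounded_bilinear_matrix_mult, of A]
            bounded_linear_transpose] has_derivative_ident]
        has_derivative_ident] .
  from has_derivative_compose[OF this D]
  have "((\<lambda>P. trace (matpow (transpose P ** A ** P) m)) has_derivative
      (\<lambda>X. trace (D (transpose P ** A ** X + transpose X ** A ** P)))) (at P)"
    by (rule bounded_linear.has_derivative[OF bounded_linear_trace])
  moreover have "trace (D (transpose P ** A ** X + transpose X ** A ** P))
      = 2 * real m * trace (transpose X ** A ** P ** ?N)" for X
    using tr[of "transpose P ** A ** X + transpose X ** A ** P" 0]
    by (simp add: matrix_mult_add_left trace_add trace_mixed_swap[OF sym, of P X])
  ultimately show ?thesis by simp
qed

lemma trace_transpose_mult: "trace (transpose X ** Y) = X \<bullet> Y" for X Y :: "real^'k^'n"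
  by (simp add: trace_def transpose_def matrix_matrix_mult_def inner_vec_def) (rule sum.swap)

text \<open>The entries of the gradient are the values of \<open>D\<close> at the matrix units, and
  the trace is the Frobenius inner product, so linearity of \<open>D\<close> gives the claim. It
  links partial derivatives to the Frechet derivative.\<close>

lemma trace_matrix_grad:
  fixes f :: "real^'k^'n \<Rightarrow> real"
  assumes D: "(f has_derivative D) (at P)"
  shows "trace (transpose X ** matrix_grad f P) = D X"
proof -
  have lin: "linear D" using D by (rule has_derivative_linear)
  have grad: "matrix_grad f P $ i $ j = D (axis i (axis j 1))" for i j
  proof -
    let ?E = "axis i (axis j 1) :: real^'k^'n"
    have "((\<lambda>t. f (P + t *\<^sub>R ?E)) has_derivative (\<lambda>t. D (t *\<^sub>R ?E))) (at 0)"
      by (rule has_derivative_compose[of "\<lambda>t. P + t *\<^sub>R ?E" "\<lambda>t. t *\<^sub>R ?E"])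
        (auto intro!: derivative_eq_intros simp: D)
    then have "((\<lambda>t. f (P + t *\<^sub>R ?E)) has_real_derivative D ?E) (at 0)"
      by (rule has_derivative_imp_has_field_derivative) (simp add: linear_cmul[OF lin])
    then show ?thesis by (simp add: matrix_grad_def DERIV_imp_deriv)
  qed
  have X: "X = (\<Sum>i\<in>UNIV. \<Sum>j\<in>UNIV. X $ i $ j *\<^sub>R axis i (axis j 1))"
  proof -
    have "(\<Sum>j\<in>UNIV. X $ i $ j *\<^sub>R axis i (axis j 1)) = (axis i (X $ i) :: real^'k^'n)" for i
      by (auto simp: vec_eq_iff axis_def if_distrib cong: if_cong)
    then show ?thesis
      by (simp only:) (subst vec_eq_iff, simp add: axis_def)
  qed
  show ?thesis
    unfolding trace_transpose_mult
    by (subst (2) X) (simp add: inner_vec_def grad linear_sum[OF lin] linear_cmul[OF lin])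
qed

section \<open>The trace power function\<close>

lemma pos_semidef_congruence:
  fixes A :: "real^'n^'n" and P :: "real^'k^'n"
  assumes "pos_semidef A"
  shows "pos_semidef (transpose P ** A ** P)"
  unfolding pos_semidef_def
proof
  show "transpose (transpose P ** A ** P) = transpose P ** A ** P"
    using assms by (simp add: pos_semidef_def matrix_transpose_mul matrix_mul_assoc)
  show "\<forall>x. 0 \<le> x \<bullet> ((transpose P ** A ** P) *v x)"
  proof
    fix x :: "real^'k"
    have "x \<bullet> ((transpose P ** A ** P) *v x) = (P *v x) \<bullet> (A *v (P *v x))"
      by (simp only: matrix_vector_mul_assoc[symmetric] dot_lmul_matrix[of x "transpose P", symmetric]
          vector_transpose_matrix)
    then show "0 \<le> x \<bullet> ((transpose P ** A ** P) *v x)"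
      using assms by (simp add: pos_semidef_def)
  qed
qed

text \<open>Nonnegativity of \<open>tr (C M\<^sup>m\<^sup>-\<^sup>1)\<close> with \<open>C = (Q - P)\<^sup>T A (Q - P)\<close> bounds twice the mixed trace by
  \<open>tr ((Q\<^sup>T A Q) M\<^sup>m\<^sup>-\<^sup>1) + tr (M\<^sup>m)\<close>, where \<open>M = P\<^sup>T A P\<close>.\<close>

lemma trace_matpow_mixed_le:
  fixes A :: "real^'n^'n" and P Q :: "real^'k^'n"
  assumes A: "pos_semidef A" and m: "m \<ge> 1"
  shows "2 * real m * trace (transpose Q ** A ** P ** matpow (transpose P ** A ** P) (m - 1))
    \<le> trace (matpow (transpose Q ** A ** Q) m)
      + (2 * real m - 1) * trace (matpow (transpose P ** A ** P) m)"
proof -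
  obtain l where l: "m = Suc l" using m by (cases m) auto
  let ?M = "transpose P ** A ** P" and ?N = "transpose Q ** A ** Q"
  let ?C = "transpose (Q - P) ** A ** (Q - P)"
  let ?T = "trace (transpose Q ** A ** P ** matpow ?M l)"
  have symA: "transpose A = A" using A by (simp add: pos_semidef_def)
  have psd: "pos_semidef ?M" "pos_semidef ?N" "pos_semidef ?C"
    using A by (auto intro: pos_semidef_congruence)
  have swap: "trace (transpose P ** A ** Q ** matpow ?M l) = ?T"
    by (rule trace_mixed_swap[OF symA])
  have "?C ** matpow ?M l = ?N ** matpow ?M l - transpose Q ** A ** P ** matpow ?M l
      - transpose P ** A ** Q ** matpow ?M l + ?M ** matpow ?M l"
    by (simp add: linear_diff[OF bounded_linear.linear[OF bounded_linear_transpose]]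
        matrix_mult_diff_left matrix_mult_diff_right matrix_mult_add_left)
  then have "trace (?C ** matpow ?M l) = trace (?N ** matpow ?M l) - 2 * ?T + trace (matpow ?M m)"
    by (simp add: trace_add trace_sub swap l)
  with trace_mult_matpow_nonneg[OF psd(3,1), of l]
  have "2 * ?T \<le> trace (?N ** matpow ?M l) + trace (matpow ?M m)" by simp
  then have "real m * (2 * ?T) \<le> real m * (trace (?N ** matpow ?M l) + trace (matpow ?M m))"
    by (rule mult_left_mono) simp
  \<comment> \<open>Klein's inequality contributes \<open>real m - 1\<close> copies of
    \<open>trace (matpow ?M m)\<close> to the \<open>real m\<close> copies already present.\<close>
  also have "\<dots> \<le> trace (matpow ?N m) + (2 * real m - 1) * trace (matpow ?M m)"
    using Klein_trace_matpow[OF psd(2,1), of l] by (simp add: l algebra_simps)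
  finally show ?thesis by (simp add: l algebra_simps)
qed

text \<open>Only the point 0 needs an argument: there the difference quotient has absolute value
  \<open>\<bar>h\<bar> powr (s - 1)\<close>, which tends to 0 because \<open>s > 1\<close>. The
  derivative is two-sided, as the chain rule requires.\<close>

lemma powr_has_real_derivative_nonneg:
  fixes x s :: real
  assumes x: "0 \<le> x" and s: "1 < s"
  shows "((\<lambda>y. y powr s) has_real_derivative s * x powr (s - 1)) (at x)"
proof (cases "x = 0")
  case True
  have "((\<lambda>h. \<bar>h\<bar> powr (s - 1)) \<longlongrightarrow> 0) (at 0)"
    by (rule tendsto_eq_intros | use s in force)+
  moreover have "norm (h powr s / h) = \<bar>h\<bar> powr (s - 1)" if "h \<noteq> 0" for h :: real
  proof -
    \<comment> \<open>For negative \<open>h\<close> the convention that \<open>ln\<close> is even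
      determines the value of \<open>powr\<close>.\<close>
    have "h powr s = \<bar>h\<bar> powr s" by (simp add: powr_def abs_if ln_minus)
    then show ?thesis using that by (simp add: powr_diff)
  qed
  ultimately have "((\<lambda>h. norm (h powr s / h)) \<longlongrightarrow> 0) (at 0)"
    by (subst tendsto_cong[of _ "\<lambda>h. \<bar>h\<bar> powr (s - 1)"]) (auto simp: eventually_at_filter)
  then have "((\<lambda>h. h powr s / h) \<longlongrightarrow> 0) (at 0)"
    by (rule tendsto_norm_zero_cancel)
  then show ?thesis by (simp add: True DERIV_def)
next
  case False
  then show ?thesis using x has_real_derivative_powr[of x s] by simp
qed

text \<open>Young's inequality for \<open>a\<close> and \<open>b powr (s - 1)\<close> with conjugate
  exponents \<open>s\<close> and \<open>s / (s - 1)\<close>, multiplied by \<open>s\<close>.\<close>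

lemma Young_powr:
  fixes a b s :: real
  assumes "0 \<le> a" "0 \<le> b" "1 < s"
  shows "s * b powr (s - 1) * a \<le> a powr s + (s - 1) * b powr s"
proof -
  have "a * b powr (s - 1) \<le> a powr s / s + (b powr (s - 1)) powr (s / (s - 1)) / (s / (s - 1))"
    using assms by (intro Youngs_inequality) (auto simp: field_simps)
  also have "(b powr (s - 1)) powr (s / (s - 1)) = b powr s"
    using assms by (simp add: powr_powr)
  finally have "s * (a * b powr (s - 1)) \<le> s * (a powr s / s + b powr s / (s / (s - 1)))"
    using assms by (intro mult_left_mono) auto
  also have "\<dots> = a powr s + (s - 1) * b powr s"
    using assms by (simp add: field_simps)
  finally show ?thesis by (simp add: mult_ac)
qed

theorem corollary4p2:
  fixes A :: "real^'n^'n" and m :: nat and s :: real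
    and g :: "real^'k^'n \<Rightarrow> real"
  assumes kn: "CARD('k) \<le> CARD('n)"
    and sym: "transpose A = A"
    and m: "m \<ge> 1"
    and s: "s > 1"
    and psd: "pos_semidef A"
    and g: "g = trace_pow A m s"
  shows "(\<forall>P. g differentiable (at P)) \<and>
    (\<forall>P. trace (transpose P ** matrix_grad g P) = 2 * s * real m * g P) \<and>
    (\<forall>P Pt. trace (transpose Pt ** matrix_grad g P) \<le> g Pt + (2 * s * real m - 1) * g P) \<and>
    NPDo_cond1 g stiefel (1 + (2 * s * real m - 1)) \<and>
    (\<forall>P\<in>stiefel. \<forall>Ph\<in>stiefel.
       NPDo_cond2_witness g stiefel 1 (2 * s * real m - 1) P Ph (mat 1)) \<and>
    atomic_NPDo g"
proof -
  define f :: "real^'k^'n \<Rightarrow> real" where "f P = trace (matpow (transpose P ** A ** P) m)" for P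
  \<comment> \<open>Up to the factor \<open>2 * real m\<close>, this is the derivative of
    \<open>f\<close> at \<open>P\<close> in the direction \<open>X\<close>.\<close>
  define T where "T P X = trace (transpose X ** A ** P ** matpow (transpose P ** A ** P) (m - 1))"
    for P X :: "real^'k^'n"
  have gf: "g P = f P powr s" for P
    by (simp add: g trace_pow_def f_def)
  have f0: "0 \<le> f P" for P
  proof -
    have "pos_semidef (transpose P ** A ** P)" using psd by (rule pos_semidef_congruence)
    from trace_mult_matpow_nonneg[OF this this, of "m - 1"] show ?thesis
      using m by (cases m) (simp_all add: f_def)
  qed
  \<comment> \<open>Where \<open>f P = 0\<close> both sides vanish, since
    \<open>0 powr s = 0\<close>.\<close>
  have powr_Suc: "f P powr (s - 1) * f P = g P" for P
    using f0[of P] s by (cases "f P = 0") (auto simp: gf powr_diff)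
  have deriv: "(g has_derivative (\<lambda>X. s * f P powr (s - 1) * (2 * real m * T P X))) (at P)" for P
  proof -
    have "(f has_derivative (\<lambda>X. 2 * real m * T P X)) (at P)"
      using trace_matpow_congruence_has_derivative[OF sym, of m P]
      unfolding f_def[abs_def] T_def .
    from has_derivative_compose[OF this
        powr_has_real_derivative_nonneg[OF f0 s, unfolded has_field_derivative_def]]
    show ?thesis by (simp add: gf[abs_def])
  qed
  then have diff: "\<forall>P. g differentiable (at P)"
    by (auto simp: differentiable_def)
  have grad: "trace (transpose X ** matrix_grad g P) = s * f P powr (s - 1) * (2 * real m * T P X)"
    for P X
    by (rule trace_matrix_grad[OF deriv])
  have euler: "\<forall>P. trace (transpose P ** matrix_grad g P) = 2 * s * real m * g P"
  proof
    fix P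
    have "T P P = f P" using m by (cases m) (simp_all add: T_def f_def)
    then show "trace (transpose P ** matrix_grad g P) = 2 * s * real m * g P"
      unfolding grad powr_Suc[symmetric] by simp
  qed
  have ineq: "\<forall>P Pt. trace (transpose Pt ** matrix_grad g P) \<le> g Pt + (2 * s * real m - 1) * g P"
  proof (intro allI)
    fix P Pt
    have "s * f P powr (s - 1) * (2 * real m * T P Pt)
        \<le> s * f P powr (s - 1) * (f Pt + (2 * real m - 1) * f P)"
      using s trace_matpow_mixed_le[OF psd m, of Pt P]
      unfolding T_def f_def by (intro mult_left_mono) auto
    also have "\<dots> = s * f P powr (s - 1) * f Pt + s * (2 * real m - 1) * g P"
      unfolding powr_Suc[symmetric] by (simp add: algebra_simps)
    \<comment> \<open>Young's inequality adds \<open>(s - 1) * g P\<close>, and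
      \<open>s * (2 * real m - 1) + (s - 1) = 2 * s * real m - 1\<close>.\<close>
    also have "\<dots> \<le> g Pt + (2 * s * real m - 1) * g P"
      using Young_powr[OF f0[of Pt] f0[of P] s] by (simp add: gf algebra_simps)
    finally show "trace (transpose Pt ** matrix_grad g P) \<le> g Pt + (2 * s * real m - 1) * g P"
      unfolding grad .
  qed
  have cond1: "NPDo_cond1 g stiefel (1 + (2 * s * real m - 1))"
    using euler by (simp add: NPDo_cond1_def)
  have cond2: "\<forall>P\<in>stiefel. \<forall>Ph\<in>stiefel.
      NPDo_cond2_witness g stiefel 1 (2 * s * real m - 1) P Ph (mat 1)"
    using ineq by (simp add: NPDo_cond2_witness_def stiefel_def)
  have "1 * 1 \<le> s * real m"
    using s m by (intro mult_mono) auto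
  then have beta: "0 \<le> 2 * s * real m - 1" by simp
  \<comment> \<open>Differentiability holds on the whole space, so any positive radius will
    do.\<close>
  have "\<exists>\<delta>>0. g differentiable_on stiefel_nbhd \<delta>"
    using diff by (intro exI[of _ 1]) (auto intro: differentiable_at_imp_differentiable_on)
  moreover have "NPDo_cond2 g stiefel 1 (2 * s * real m - 1)"
    using cond2 unfolding NPDo_cond2_def by blast
  ultimately have "atomic_NPDo g"
    unfolding atomic_NPDo_def using cond1 beta zero_less_one by blast
  then show ?thesis using diff euler ineq cond1 cond2 by blast
qed

end
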